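(* Fix $c\in\mathfrak{h}^*$. Define a map $\phi_c\colon(\mu_H^{-1}(c)\cap L)\times H\to M$ by $\phi_c(x,h)=xh$. Set $u=(0,\dots,0,-\sum_{i=1}^d\lambda_i)\in\mathbb{R}^{d+1}$, and let $u^\perp_{(x,h)}$ be the component of the vector $u\in T_{\phi_c(x,h)}M\cong\mathbb{C}^{d+1}$ normal to the immersion $\phi_c$ at $(x,h)$. Then the mean curvature vector $\mathcal{H}^c$ of $\phi_c$ is given by $\mathcal{H}^c_{(x,h)}=u^\perp_{(x,h)}\in T_{\phi_c(x,h)}M$. That is, $\phi_c$ is a translating soliton.
   Context: $M=\mathbb{C}^{d+1}$ with its standard complex structure, K\"ahler form, holomorphic volume form and flat metric. $H=\mathbb{R}$ with Lie algebra $\mathfrak{h}$; $\xi_0\in\mathfrak{h}$ is such that $\mathrm{Exp}_Ht\xi_0=t$, and $\xi^0\in\mathfrak{h}^*$ satisfies $\langle\xi^0,\xi_0\rangle=1$. Fix $\lambda_1,\dots,\lambda_d\in\mathbb{R}$; $H$ acts on $M$ from the right by $z\,\mathrm{Exp}_Ht\xi_0=(z_1e^{\sqrt{-1}\lambda_1t},\dots,z_de^{\sqrt{-1}\lambda_dt},z_{d+1}+\sqrt{-1}t)$, with moment map $\mu_H(z)=(\frac12\sum_{i=1}^d\lambda_i|z_i|^2+\mathrm{Re}\,z_{d+1})\xi^0$. $L=\mathbb{R}^{d+1}\subset M$. *)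

theory Defs
  imports "HOL-Analysis.Analysis"
begin

section \<open>Smooth maps on open sets\<close>

fun Ck_on :: "nat \<Rightarrow> 'a::euclidean_space set \<Rightarrow> ('a \<Rightarrow> 'b::euclidean_space) \<Rightarrow> bool" where
  "Ck_on 0 U f \<longleftrightarrow> continuous_on U f"
| "Ck_on (Suc k) U f \<longleftrightarrow> (\<forall>x\<in>U. f differentiable (at x)) \<and>
     (\<forall>v. Ck_on k U (\<lambda>x. frechet_derivative f (at x) v))"

definition smooth_on :: "'a::euclidean_space set \<Rightarrow> ('a \<Rightarrow> 'b::euclidean_space) \<Rightarrow> bool" where
  "smooth_on U f \<longleftrightarrow> (\<forall>k. Ck_on k U f)"

section \<open>Embedded submanifolds of a Euclidean space\<close>

definition local_parametrization ::
    "'a::euclidean_space set \<Rightarrow> 'm::euclidean_space set \<Rightarrow> ('m \<Rightarrow> 'a) \<Rightarrow> bool" where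
  "local_parametrization N U \<psi> \<longleftrightarrow>
     open U \<and> smooth_on U \<psi> \<and> (\<forall>q\<in>U. inj (frechet_derivative \<psi> (at q))) \<and>
     (\<exists>g. homeomorphism U (\<psi> ` U) \<psi> g) \<and> openin (top_of_set N) (\<psi> ` U)"

text \<open>The type argument fixes the model space \<open>'m\<close> of the local parametrizations, so
  \<open>DIM('m)\<close> is the dimension of the submanifold.\<close>

definition submanifold :: "'m::euclidean_space itself \<Rightarrow> 'a::euclidean_space set \<Rightarrow> bool" where
  "submanifold _ N \<longleftrightarrow>
     (\<forall>p\<in>N. \<exists>U (\<psi> :: 'm \<Rightarrow> 'a). local_parametrization N U \<psi> \<and> p \<in> \<psi> ` U)"

section \<open>Immersions and their mean curvature vector\<close>

definition immersion :: "'m::euclidean_space itself \<Rightarrow> 'a::euclidean_space set \<Rightarrow>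
    ('a \<Rightarrow> 'b::euclidean_space) \<Rightarrow> bool" where
  "immersion _ N f \<longleftrightarrow> submanifold TYPE('m) N \<and>
     (\<forall>U (\<psi> :: 'm \<Rightarrow> 'a). local_parametrization N U \<psi> \<longrightarrow>
        smooth_on U (f \<circ> \<psi>) \<and> (\<forall>q\<in>U. inj (frechet_derivative (f \<circ> \<psi>) (at q))))"

text \<open>The image of the differential of \<open>f\<close> at \<open>p\<close>; all local parametrizations around \<open>p\<close>
  contribute the same subspace.\<close>

definition tangent_space :: "'m::euclidean_space itself \<Rightarrow> 'a::euclidean_space set \<Rightarrow>
    ('a \<Rightarrow> 'b::euclidean_space) \<Rightarrow> 'a \<Rightarrow> 'b set" where
  "tangent_space _ N f p =
     {frechet_derivative (f \<circ> \<psi>) (at q) v | U (\<psi> :: 'm \<Rightarrow> 'a) q v.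
        local_parametrization N U \<psi> \<and> q \<in> U \<and> \<psi> q = p}"

definition normal_part :: "'b::euclidean_space set \<Rightarrow> 'b \<Rightarrow> 'b" where
  "normal_part V w = (THE n. n \<in> orthogonal_comp V \<and> w - n \<in> V)"

text \<open>Second fundamental form of a parametrized immersion \<open>F\<close> into a flat Euclidean space: the
  normal part of the ordinary second derivative.\<close>

definition second_fundamental_form ::
    "('m::euclidean_space \<Rightarrow> 'b::euclidean_space) \<Rightarrow> 'm \<Rightarrow> 'm \<Rightarrow> 'm \<Rightarrow> 'b" where
  "second_fundamental_form F q v w =
     normal_part (range (frechet_derivative F (at q)))
       (frechet_derivative (\<lambda>y. frechet_derivative F (at y) w) (at q) v)"

text \<open>A frame at \<open>q\<close>, indexed by \<open>Basis\<close>, that is orthonormal for the metric induced by \<open>F\<close>.\<close>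

definition orthonormal_frame ::
    "('m::euclidean_space \<Rightarrow> 'b::euclidean_space) \<Rightarrow> 'm \<Rightarrow> ('m \<Rightarrow> 'm) \<Rightarrow> bool" where
  "orthonormal_frame F q e \<longleftrightarrow>
     (\<forall>i\<in>Basis. \<forall>j\<in>Basis.
        frechet_derivative F (at q) (e i) \<bullet> frechet_derivative F (at q) (e j) =
          (if i = j then 1 else 0))"

text \<open>The mean curvature vector is the trace of the second fundamental form, not divided by the
  dimension. The value does not depend on the local parametrization or the frame.\<close>

definition mean_curvature :: "'m::euclidean_space itself \<Rightarrow> 'a::euclidean_space set \<Rightarrow>
    ('a \<Rightarrow> 'b::euclidean_space) \<Rightarrow> 'a \<Rightarrow> 'b" where
  "mean_curvature _ N f p =
     (THE \<eta>. \<exists>U (\<psi> :: 'm \<Rightarrow> 'a) q e.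
        local_parametrization N U \<psi> \<and> q \<in> U \<and> \<psi> q = p \<and> orthonormal_frame (f \<circ> \<psi>) q e \<and>
        \<eta> = (\<Sum>i\<in>Basis. second_fundamental_form (f \<circ> \<psi>) q (e i) (e i)))"

definition translating_soliton :: "'m::euclidean_space itself \<Rightarrow> 'a::euclidean_space set \<Rightarrow>
    ('a \<Rightarrow> 'b::euclidean_space) \<Rightarrow> bool" where
  "translating_soliton T N f \<longleftrightarrow> immersion T N f \<and>
     (\<exists>u. \<forall>p\<in>N. mean_curvature T N f p = normal_part (tangent_space T N f p) u)"

section \<open>The action of \<open>H = \<real>\<close> on \<open>\<complex>\<^sup>d\<^sup>+\<^sup>1\<close>\<close>

text \<open>A point \<open>(z\<^sub>1, \<dots>, z\<^sub>d, z\<^sub>d\<^sub>+\<^sub>1)\<close> is a pair \<open>(z, w)\<close> with \<open>w = z\<^sub>d\<^sub>+\<^sub>1\<close>; the inner product of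
  this type is the flat metric, the real part of the standard Hermitian form. The group \<open>H\<close> and its
  Lie algebra are both \<open>real\<close> with the identity as exponential map, so that \<open>\<xi>\<^sub>0 = 1\<close>.\<close>

type_synonym 'd cspace = "(complex ^ 'd) \<times> complex"
type_synonym H = real
type_synonym lie_H = real
type_synonym dual_lie_H = "lie_H \<Rightarrow>\<^sub>L real"

definition xi_dual :: dual_lie_H where
  "xi_dual = id_blinfun"

definition act :: "real ^ 'd \<Rightarrow> 'd::finite cspace \<Rightarrow> H \<Rightarrow> 'd cspace" where
  "act lam z t =
     ((\<chi> i. fst z $ i * exp (\<i> * of_real (lam $ i * t))), snd z + \<i> * of_real t)"

definition moment_map :: "real ^ 'd \<Rightarrow> 'd::finite cspace \<Rightarrow> dual_lie_H" where
  "moment_map lam z =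
     (1/2 * (\<Sum>i\<in>UNIV. lam $ i * (cmod (fst z $ i))\<^sup>2) + Re (snd z)) *\<^sub>R xi_dual"

definition real_points :: "'d::finite cspace set" where
  "real_points = {z. (\<forall>i. fst z $ i \<in> \<real>) \<and> snd z \<in> \<real>}"

definition phi_domain :: "real ^ 'd \<Rightarrow> dual_lie_H \<Rightarrow> ('d::finite cspace \<times> H) set" where
  "phi_domain lam c = (moment_map lam -` {c} \<inter> real_points) \<times> UNIV"

definition phi :: "real ^ 'd \<Rightarrow> 'd::finite cspace \<times> H \<Rightarrow> 'd cspace" where
  "phi lam = (\<lambda>(x, h). act lam x h)"

definition translation_vector :: "real ^ 'd \<Rightarrow> 'd::finite cspace" where
  "translation_vector lam = (0, of_real (- (\<Sum>i\<in>UNIV. lam $ i)))"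

end

theory Submission
  imports Defs
begin

text \<open>
  Write \<open>\<lambda>\<close> for \<open>lam\<close> and \<open>r\<close> for the number with \<open>c = r \<xi>\<^sup>0\<close>. The level set \<open>\<mu>\<^sub>H(x) = c\<close> in \<open>L = \<real>\<^sup>d\<^sup>+\<^sup>1\<close> is the
  graph \<open>x\<^sub>d\<^sub>+\<^sub>1 = r - \<Sum>\<^sub>i \<lambda>\<^sub>i x\<^sub>i\<^sup>2 / 2\<close>, so the immersion is, in the coordinates \<open>(x, t) \<in> \<real>\<^sup>d \<times> \<real>\<close>, the map
  \<open>F(x, t) = (x\<^sub>1 cis (\<lambda>\<^sub>1 t), \<dots>, x\<^sub>d cis (\<lambda>\<^sub>d t), r - \<Sum>\<^sub>i \<lambda>\<^sub>i x\<^sub>i\<^sup>2 / 2 + \<i> t)\<close>, called \<open>orbit_point\<close> below.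
  Its derivative is injective: the imaginary part of the last coordinate recovers the velocity in \<open>t\<close>,
  and then the others recover the velocity in \<open>x\<close>.

  Put \<open>a\<^sub>i = \<lambda>\<^sub>i x\<^sub>i\<close> and \<open>s = 1 + |a|\<^sup>2\<close>. The \<open>t\<close>-direction is orthogonal to the \<open>x\<close>-directions, and the
  induced metric is \<open>I + a a\<^sup>T\<close> on the latter and \<open>s\<close> on the former, with inverse \<open>I - a a\<^sup>T / s\<close> and
  \<open>1 / s\<close> (\<open>inner_d_orbit\<close>). The mixed second
  derivatives \<open>\<partial>\<^sub>j\<partial>\<^sub>t F\<close> drop out of the trace, and the others are \<open>\<partial>\<^sub>j\<partial>\<^sub>k F = (0, - \<lambda>\<^sub>j \<delta>\<^sub>j\<^sub>k)\<close> and
  \<open>\<partial>\<^sub>t\<^sup>2 F = (- \<lambda>\<^sub>k a\<^sub>k cis (\<lambda>\<^sub>k t), 0)\<close>. Their trace is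
  \<open>u + (1/s) (- \<lambda>\<^sub>k a\<^sub>k cis (\<lambda>\<^sub>k t), \<Sum>\<^sub>i \<lambda>\<^sub>i a\<^sub>i\<^sup>2)\<close>, and the second summand is the image under \<open>dF\<close> of the
  direction \<open>(- \<lambda>\<^sub>k a\<^sub>k / s, 0)\<close> (\<open>trace_dd_orbit\<close>). The mean curvature vector, being the normal part of the
  trace, is therefore the normal part of \<open>u\<close>.

  The remaining work is invariance: mean curvature and tangent space are defined through arbitrary
  local parametrizations and arbitrary orthonormal frames. The domain is a graph, so any local
  parametrization is the graph parametrization after a smooth change of parameters
  (\<open>transition_map\<close>), and the second fundamental form is tensorial
  (\<open>second_fundamental_form_reparametrize\<close>). The trace over an arbitrary frame is read off from the
  dual vectors of the coordinates (\<open>orthonormal_frame_dual_sum\<close>).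
\<close>

section \<open>Calculus of smooth maps\<close>

lemma frechet_derivative_cong_open:
  assumes "open U" "x \<in> U" "\<And>y. y \<in> U \<Longrightarrow> f y = g y"
  shows "frechet_derivative f (at x) = frechet_derivative g (at x)"
proof -
  have "(f has_derivative D) (at x) \<longleftrightarrow> (g has_derivative D) (at x)" for D
    using has_derivative_transform_within_open[OF _ assms(1,2)] assms(3) by metis
  then show ?thesis
    unfolding frechet_derivative_def by simp
qed

lemma Ck_on_SucD:
  assumes "Ck_on (Suc k) U f"
  shows "x \<in> U \<Longrightarrow> (f has_derivative frechet_derivative f (at x)) (at x)"
    and "Ck_on k U (\<lambda>x. frechet_derivative f (at x) v)"
  using assms unfolding Ck_on.simps(2) frechet_derivative_works by simp_all

lemma Ck_on_cong:
  assumes "open U" "\<And>x. x \<in> U \<Longrightarrow> f x = g x" "Ck_on k U f"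
  shows "Ck_on k U g"
  using assms(2,3)
proof (induction k arbitrary: f g)
  case 0
  then show ?case
    by (metis Ck_on.simps(1) continuous_on_cong)
next
  case (Suc k)
  have eq: "frechet_derivative f (at x) = frechet_derivative g (at x)" if "x \<in> U" for x
    using frechet_derivative_cong_open[OF assms(1) that] Suc.prems(1) by blast
  have "g differentiable (at x)" if "x \<in> U" for x
    using has_derivative_transform_within_open[OF Ck_on_SucD(1)[OF Suc.prems(2) that] assms(1) that]
      Suc.prems(1) unfolding differentiable_def by blast
  moreover have "Ck_on k U (\<lambda>x. frechet_derivative g (at x) v)" for v
    using eq by (intro Suc.IH[OF _ Ck_on_SucD(2)[OF Suc.prems(2)]]) simp
  ultimately show ?case by simp
qed

text \<open>The successor case of \<^const>\<open>Ck_on\<close> speaks about the chosen derivative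
  \<^const>\<open>frechet_derivative\<close>; this form accepts any derivative that a calculus rule produces.\<close>

lemma Ck_on_SucI:
  assumes "open U" "\<And>x. x \<in> U \<Longrightarrow> (f has_derivative D x) (at x)" "\<And>v. Ck_on k U (\<lambda>x. D x v)"
  shows "Ck_on (Suc k) U f"
proof -
  have "D x v = frechet_derivative f (at x) v" if "x \<in> U" for x v
    using frechet_derivative_at[OF assms(2)[OF that]] by simp
  then have "Ck_on k U (\<lambda>x. frechet_derivative f (at x) v)" for v
    using Ck_on_cong[OF assms(1) _ assms(3)] by simp
  moreover have "\<forall>x\<in>U. f differentiable (at x)"
    using assms(2) differentiable_def by blast
  ultimately show ?thesis by simp
qed

lemma Ck_on_Suc_imp:
  assumes "open U" "Ck_on (Suc k) U f"
  shows "Ck_on k U f"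
  using assms(2)
proof (induction k arbitrary: f)
  case 0
  have "f differentiable_on U"
    using Ck_on_SucD(1)[OF 0] unfolding differentiable_def
    by (intro differentiable_at_imp_differentiable_on) (auto simp: differentiable_def)
  then show ?case
    by (simp add: differentiable_imp_continuous_on)
next
  case (Suc k)
  show ?case
    by (rule Ck_on_SucI[OF assms(1) Ck_on_SucD(1)[OF Suc.prems] Suc.IH[OF Ck_on_SucD(2)[OF Suc.prems]]])
qed

lemma Ck_on_const:
  fixes c :: "'b::euclidean_space"
  assumes "open U"
  shows "Ck_on k U (\<lambda>x. c)"
proof (induction k arbitrary: c)
  case 0
  show ?case by (simp only: Ck_on.simps continuous_on_const)
next
  case (Suc k)
  show ?case
  proof (rule Ck_on_SucI[where D = "\<lambda>_ _. 0"])
    show "Ck_on k U (\<lambda>x. 0 :: 'b)" by (rule Suc.IH)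
  qed (use assms in simp_all)
qed

lemma Ck_on_add:
  assumes "open U" "Ck_on k U f" "Ck_on k U g"
  shows "Ck_on k U (\<lambda>x. f x + g x)"
  using assms(2,3)
proof (induction k arbitrary: f g)
  case (Suc k)
  show ?case
    by (rule Ck_on_SucI[OF assms(1) has_derivative_add[OF Suc.prems[THEN Ck_on_SucD(1)]]
          Suc.IH[OF Suc.prems[THEN Ck_on_SucD(2)]]])
qed (simp add: continuous_on_add)

lemma Ck_on_linear:
  assumes "open U" "bounded_linear L" "Ck_on k U f"
  shows "Ck_on k U (\<lambda>x. L (f x))"
  using assms(3)
proof (induction k arbitrary: f)
  case 0
  then show ?case using bounded_linear.continuous_on[OF assms(2)] by simp
next
  case (Suc k)
  show ?case
    by (rule Ck_on_SucI[OF assms(1) bounded_linear.has_derivative[OF assms(2) Ck_on_SucD(1)[OF Suc.prems]]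
          Suc.IH[OF Ck_on_SucD(2)[OF Suc.prems]]])
qed

lemma Ck_on_bilinear:
  assumes "open U" "bounded_bilinear h" "Ck_on k U f" "Ck_on k U g"
  shows "Ck_on k U (\<lambda>x. h (f x) (g x))"
  using assms(3,4)
proof (induction k arbitrary: f g)
  case 0
  then show ?case using bounded_bilinear.continuous_on[OF assms(2)] by simp
next
  case (Suc k)
  show ?case
  proof (rule Ck_on_SucI[OF assms(1) bounded_bilinear.FDERIV[OF assms(2) Suc.prems[THEN Ck_on_SucD(1)]]])
    show "Ck_on k U (\<lambda>x. h (f x) (frechet_derivative g (at x) v) + h (frechet_derivative f (at x) v) (g x))" for v
      by (intro Ck_on_add[OF assms(1)] Suc.IH Suc.prems[THEN Ck_on_Suc_imp[OF assms(1)]]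
          Suc.prems[THEN Ck_on_SucD(2)])
  qed
qed

lemma Ck_on_sum:
  assumes "open U" "finite I" "\<And>i. i \<in> I \<Longrightarrow> Ck_on k U (f i)"
  shows "Ck_on k U (\<lambda>x. \<Sum>i\<in>I. f i x)"
  using assms(2,3)
proof (induction I)
  case empty
  then show ?case by (simp add: Ck_on_const[OF assms(1)])
next
  case (insert i I)
  then show ?case by (simp add: Ck_on_add[OF assms(1)])
qed

lemma linear_basis_expansion:
  fixes L :: "'a::euclidean_space \<Rightarrow> 'b::real_vector"
  assumes "linear L"
  shows "L v = (\<Sum>b\<in>Basis. (v \<bullet> b) *\<^sub>R L b)"
proof -
  have "L v = L (\<Sum>b\<in>Basis. (v \<bullet> b) *\<^sub>R b)"
    by (simp add: euclidean_representation)
  also have "\<dots> = (\<Sum>b\<in>Basis. (v \<bullet> b) *\<^sub>R L b)"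
    by (simp add: linear_sum[OF assms] linear_scale[OF assms])
  finally show ?thesis .
qed

text \<open>The chain rule expresses the derivative of \<open>g \<circ> f\<close> as \<open>x \<mapsto> Dg (f x) (Df x v)\<close>, where both the map \<open>Dg (f x)\<close>
  and its argument depend on \<open>x\<close>. Expanding the argument in the basis separates them into a sum of
  products, to which the induction hypothesis and the product rule apply.\<close>

lemma Ck_on_compose:
  fixes g :: "'b::euclidean_space \<Rightarrow> 'c::euclidean_space"
  assumes "open U" "f ` U \<subseteq> V" "Ck_on k U f" "Ck_on k V g"
  shows "Ck_on k U (\<lambda>x. g (f x))"
  using assms(3,4)
proof (induction k arbitrary: g)
  case 0
  then show ?case using continuous_on_compose2 assms(2) by (metis Ck_on.simps(1))
next
  case (Suc k)
  have V: "f x \<in> V" if "x \<in> U" for x using assms(2) that by auto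
  have D: "((\<lambda>x. g (f x)) has_derivative
      (\<lambda>v. \<Sum>b\<in>Basis. (frechet_derivative f (at x) v \<bullet> b) *\<^sub>R frechet_derivative g (at (f x)) b)) (at x)"
    if "x \<in> U" for x
  proof -
    note dg = Ck_on_SucD(1)[OF Suc.prems(2) V[OF that]]
    show ?thesis
      using has_derivative_compose[OF Ck_on_SucD(1)[OF Suc.prems(1) that] dg]
      by (subst (asm) linear_basis_expansion[OF has_derivative_linear[OF dg]])
  qed
  show ?case
  proof (rule Ck_on_SucI[OF assms(1) D])
    show "Ck_on k U (\<lambda>x. \<Sum>b\<in>Basis. (frechet_derivative f (at x) v \<bullet> b) *\<^sub>R frechet_derivative g (at (f x)) b)" for v
    proof (intro Ck_on_sum[OF assms(1)] Ck_on_bilinear[OF assms(1) bounded_bilinear_scaleR])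
      show "Ck_on k U (\<lambda>x. frechet_derivative f (at x) v \<bullet> b)" for b
        by (rule Ck_on_linear[OF assms(1) bounded_linear_inner_left Ck_on_SucD(2)[OF Suc.prems(1)]])
      show "Ck_on k U (\<lambda>x. frechet_derivative g (at (f x)) b)" for b
        by (rule Suc.IH[OF Ck_on_Suc_imp[OF assms(1) Suc.prems(1)] Ck_on_SucD(2)[OF Suc.prems(2)]])
    qed simp
  qed
qed

lemma smooth_onD_derivative:
  assumes "smooth_on U f" "x \<in> U"
  shows "(f has_derivative frechet_derivative f (at x)) (at x)"
  using assms Ck_on_SucD(1)[of 0] unfolding smooth_on_def by blast

lemma smooth_on_derivative: "smooth_on U f \<Longrightarrow> smooth_on U (\<lambda>x. frechet_derivative f (at x) v)"
  unfolding smooth_on_def by (metis Ck_on.simps(2))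

lemma smooth_on_ident:
  assumes "open U"
  shows "smooth_on U (\<lambda>x. x)"
  unfolding smooth_on_def
proof
  show "Ck_on k U (\<lambda>x. x)" for k
  proof (cases k)
    case (Suc j)
    show ?thesis
      unfolding Suc
    proof (rule Ck_on_SucI[where D = "\<lambda>_ v. v"])
      show "Ck_on j U (\<lambda>x. v)" for v :: 'a by (rule Ck_on_const[OF assms])
    qed (use assms in simp_all)
  qed simp
qed

lemma smooth_on_cong:
  assumes "open U" "\<And>x. x \<in> U \<Longrightarrow> f x = g x" "smooth_on U f"
  shows "smooth_on U g"
  using assms Ck_on_cong unfolding smooth_on_def by metis

lemma smooth_on_const: "open U \<Longrightarrow> smooth_on U (\<lambda>x. c)"
  by (simp add: smooth_on_def Ck_on_const)

lemma smooth_on_add: "open U \<Longrightarrow> smooth_on U f \<Longrightarrow> smooth_on U g \<Longrightarrow> smooth_on U (\<lambda>x. f x + g x)"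
  by (simp add: smooth_on_def Ck_on_add)

lemma smooth_on_linear:
  "open U \<Longrightarrow> bounded_linear L \<Longrightarrow> smooth_on U f \<Longrightarrow> smooth_on U (\<lambda>x. L (f x))"
  by (simp add: smooth_on_def Ck_on_linear)

lemma smooth_on_bilinear:
  "open U \<Longrightarrow> bounded_bilinear h \<Longrightarrow> smooth_on U f \<Longrightarrow> smooth_on U g \<Longrightarrow>
    smooth_on U (\<lambda>x. h (f x) (g x))"
  by (simp add: smooth_on_def Ck_on_bilinear)

lemma smooth_on_sum:
  "open U \<Longrightarrow> finite I \<Longrightarrow> (\<And>i. i \<in> I \<Longrightarrow> smooth_on U (f i)) \<Longrightarrow> smooth_on U (\<lambda>x. \<Sum>i\<in>I. f i x)"
  by (simp add: smooth_on_def Ck_on_sum)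

lemma smooth_on_compose:
  "open U \<Longrightarrow> f ` U \<subseteq> V \<Longrightarrow> smooth_on U f \<Longrightarrow> smooth_on V g \<Longrightarrow> smooth_on U (\<lambda>x. g (f x))"
  unfolding smooth_on_def using Ck_on_compose by blast

lemma smooth_on_Pair:
  assumes "open U" "smooth_on U f" "smooth_on U g"
  shows "smooth_on U (\<lambda>x. (f x, g x))"
proof -
  have "smooth_on U (\<lambda>x. (f x, 0) + (0, g x))"
    by (rule smooth_on_add[OF assms(1)
          smooth_on_linear[OF assms(1) bounded_linear_Pair[OF bounded_linear_ident bounded_linear_zero] assms(2)]
          smooth_on_linear[OF assms(1) bounded_linear_Pair[OF bounded_linear_zero bounded_linear_ident] assms(3)]])
  then show ?thesis by simp
qed

lemma bounded_linear_axis: "bounded_linear (axis i :: 'b::euclidean_space \<Rightarrow> 'b ^ 'n::finite)"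
  by (rule linear_conv_bounded_linear[THEN iffD1], rule linearI)
    (auto simp: vec_eq_iff axis_def)

lemma smooth_on_vec_lambda:
  fixes f :: "'a::euclidean_space \<Rightarrow> 'n::finite \<Rightarrow> 'b::euclidean_space"
  assumes "open U" "\<And>i. smooth_on U (\<lambda>x. f x i)"
  shows "smooth_on U (\<lambda>x. \<chi> i. f x i)"
proof -
  have "smooth_on U (\<lambda>x. \<Sum>i\<in>UNIV. axis i (f x i))"
    by (intro smooth_on_sum[OF assms(1)] smooth_on_linear[OF assms(1) bounded_linear_axis assms(2)] finite)
  moreover have "(\<Sum>i\<in>UNIV. axis i (f x i)) = (\<chi> i. f x i)" for x
    by (simp add: vec_eq_iff axis_def)
  ultimately show ?thesis by simp
qed

lemma smooth_on_cis:
  assumes "open U" "smooth_on U g"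
  shows "smooth_on U (\<lambda>x. cis (g x))"
proof -
  have "Ck_on k UNIV cis" for k
  proof (induction k)
    case 0
    show ?case by (simp add: continuous_on_cis)
  next
    case (Suc k)
    show ?case
    proof (rule Ck_on_SucI[OF open_UNIV has_derivative_cis[OF has_derivative_ident]])
      show "Ck_on k UNIV (\<lambda>x. v *\<^sub>R (\<i> * cis x))" for v
        by (intro Ck_on_linear[OF open_UNIV bounded_linear_scaleR_right]
            Ck_on_linear[OF open_UNIV bounded_linear_mult_right] Suc.IH)
    qed
  qed
  then show ?thesis
    using smooth_on_compose[OF assms(1) _ assms(2), of UNIV cis] by (simp add: smooth_on_def)
qed

lemma has_derivative_vec_lambda:
  fixes f :: "'a::real_normed_vector \<Rightarrow> 'n::finite \<Rightarrow> 'b::euclidean_space"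
  assumes "\<And>i. ((\<lambda>x. f x i) has_derivative D i) F"
  shows "((\<lambda>x. \<chi> i. f x i) has_derivative (\<lambda>v. \<chi> i. D i v)) F"
proof -
  have eq: "(\<Sum>i\<in>UNIV. axis i (g i)) = (\<chi> i. g i)" for g :: "'n \<Rightarrow> 'b"
    by (simp add: vec_eq_iff axis_def)
  have "((\<lambda>x. \<Sum>i\<in>UNIV. axis i (f x i)) has_derivative (\<lambda>v. \<Sum>i\<in>UNIV. axis i (D i v))) F"
    by (intro has_derivative_sum bounded_linear.has_derivative[OF bounded_linear_axis] assms)
  then show ?thesis unfolding eq .
qed

section \<open>Normal parts\<close>

lemma normal_part_eqI:
  assumes "subspace V" "n \<in> orthogonal_comp V" "w - n \<in> V"
  shows "normal_part V w = n"
  unfolding normal_part_def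
proof (rule the_equality)
  fix m assume m: "m \<in> orthogonal_comp V \<and> w - m \<in> V"
  have "(w - m) - (w - n) \<in> V"
    using subspace_diff[OF assms(1)] m assms(3) by blast
  then have 1: "n - m \<in> V" by simp
  have "n - m \<in> orthogonal_comp V"
    using subspace_diff[OF subspace_orthogonal_comp] m assms(2) by blast
  then have "orthogonal (n - m) (n - m)"
    using 1 unfolding orthogonal_comp_def by blast
  then show "m = n"
    by (simp add: orthogonal_self)
qed (use assms in simp)

lemma normal_part_decomposition:
  fixes V :: "'b::euclidean_space set"
  assumes "subspace V"
  shows "normal_part V w \<in> orthogonal_comp V" and "w - normal_part V w \<in> V"
proof -
  have "w \<in> V + orthogonal_comp V"
    using subspace_sum_orthogonal_comp[OF assms] by simp
  then obtain v n where "v \<in> V" "n \<in> orthogonal_comp V" "w = v + n"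
    by (elim set_plus_elim)
  moreover from this have "normal_part V w = n"
    by (intro normal_part_eqI[OF assms]) auto
  ultimately show "normal_part V w \<in> orthogonal_comp V" "w - normal_part V w \<in> V"
    by auto
qed

lemma normal_part_cong:
  fixes V :: "'b::euclidean_space set"
  assumes "subspace V" "w - w' \<in> V"
  shows "normal_part V w = normal_part V w'"
proof (rule normal_part_eqI[OF assms(1)])
  have "(w - w') + (w' - normal_part V w') \<in> V"
    using subspace_add[OF assms(1)] assms(2) normal_part_decomposition(2)[OF assms(1)] by blast
  then show "w - normal_part V w' \<in> V" by simp
qed (rule normal_part_decomposition(1)[OF assms(1)])

lemma normal_part_sum:
  fixes V :: "'b::euclidean_space set"
  assumes "subspace V"
  shows "(\<Sum>i\<in>I. normal_part V (f i)) = normal_part V (\<Sum>i\<in>I. f i)"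
proof (rule normal_part_eqI[OF assms, symmetric])
  show "(\<Sum>i\<in>I. normal_part V (f i)) \<in> orthogonal_comp V"
    by (intro subspace_sum subspace_orthogonal_comp normal_part_decomposition(1)[OF assms])
  show "(\<Sum>i\<in>I. f i) - (\<Sum>i\<in>I. normal_part V (f i)) \<in> V"
    unfolding sum_subtractf[symmetric]
    by (intro subspace_sum[OF assms] normal_part_decomposition(2)[OF assms])
qed

section \<open>Second fundamental form and orthonormal frames\<close>

lemma subspace_range_derivative:
  assumes "(F has_derivative F') (at x)"
  shows "subspace (range F')"
  using linear_subspace_image[OF has_derivative_linear[OF assms] subspace_UNIV] .

lemma frechet_derivative_comp_open:
  assumes "open U" "q \<in> U" "\<And>y. y \<in> U \<Longrightarrow> G y = F (\<sigma> y)"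
    and "smooth_on U \<sigma>" "smooth_on UNIV F"
  shows "frechet_derivative G (at q) = (\<lambda>v. frechet_derivative F (at (\<sigma> q)) (frechet_derivative \<sigma> (at q) v))"
proof -
  have "((\<lambda>y. F (\<sigma> y)) has_derivative
      (\<lambda>v. frechet_derivative F (at (\<sigma> q)) (frechet_derivative \<sigma> (at q) v))) (at q)"
    using has_derivative_compose[OF smooth_onD_derivative[OF assms(4,2)] smooth_onD_derivative[OF assms(5)]]
    by simp
  then show ?thesis
    using frechet_derivative_at frechet_derivative_cong_open[OF assms(1,2), of G "\<lambda>y. F (\<sigma> y)"] assms(3)
    by metis
qed

text \<open>The second derivative of \<open>F \<circ> \<sigma>\<close> is \<open>D\<^sup>2F(D\<sigma> v, D\<sigma> w) + DF(D\<^sup>2\<sigma>(v, w))\<close>. The last term is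
  tangential, so its normal part vanishes; this is why the second fundamental form is a tensor.\<close>

lemma second_fundamental_form_reparametrize:
  fixes F :: "'m::euclidean_space \<Rightarrow> 'b::euclidean_space"
    and \<sigma> :: "'n::euclidean_space \<Rightarrow> 'm"
  assumes U: "open U" "q \<in> U" and G: "\<And>y. y \<in> U \<Longrightarrow> G y = F (\<sigma> y)"
    and \<sigma>: "smooth_on U \<sigma>" and F: "smooth_on UNIV F"
    and surj: "surj (frechet_derivative \<sigma> (at q))"
  shows "second_fundamental_form G q v w =
    second_fundamental_form F (\<sigma> q) (frechet_derivative \<sigma> (at q) v) (frechet_derivative \<sigma> (at q) w)"
proof -
  define dF where "dF = (\<lambda>x. frechet_derivative F (at x))"
  define d\<sigma> where "d\<sigma> = (\<lambda>y. frechet_derivative \<sigma> (at y))"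
  define ddF where "ddF = (\<lambda>b. frechet_derivative (\<lambda>x. dF x b) (at (\<sigma> q)))"
  define dd\<sigma> where "dd\<sigma> = frechet_derivative (\<lambda>y. d\<sigma> y w) (at q)"
  have dF: "(F has_derivative dF x) (at x)" for x
    unfolding dF_def by (rule smooth_onD_derivative[OF F]) simp
  have ddF: "((\<lambda>x. dF x b) has_derivative ddF b) (at (\<sigma> q))" for b
    unfolding ddF_def dF_def by (rule smooth_onD_derivative[OF smooth_on_derivative[OF F]]) simp
  have d\<sigma>: "(\<sigma> has_derivative d\<sigma> y) (at y)" if "y \<in> U" for y
    unfolding d\<sigma>_def by (rule smooth_onD_derivative[OF \<sigma> that])
  have dd\<sigma>: "((\<lambda>y. d\<sigma> y w) has_derivative dd\<sigma>) (at q)"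
    unfolding dd\<sigma>_def d\<sigma>_def by (rule smooth_onD_derivative[OF smooth_on_derivative[OF \<sigma>] U(2)])
  \<comment> \<open>The direction in which \<open>F\<close> is differentiated moves with \<open>y\<close>. Expanding it in the basis turns the
    derivative of \<open>y \<mapsto> dF (\<sigma> y) (d\<sigma> y w)\<close> into an instance of the ordinary product rule.\<close>
  have expand: "dF x \<eta> = (\<Sum>b\<in>Basis. (\<eta> \<bullet> b) *\<^sub>R dF x b)" for x \<eta>
    by (rule linear_basis_expansion[OF has_derivative_linear[OF dF]])
  have dG: "frechet_derivative G (at y) = (\<lambda>v. dF (\<sigma> y) (d\<sigma> y v))" if "y \<in> U" for y
    unfolding dF_def d\<sigma>_def by (rule frechet_derivative_comp_open[OF U(1) that G \<sigma> F])
  have dGw: "frechet_derivative G (at y) w = (\<Sum>b\<in>Basis. (d\<sigma> y w \<bullet> b) *\<^sub>R dF (\<sigma> y) b)"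
    if "y \<in> U" for y
    unfolding dG[OF that] by (rule expand)
  have "((\<lambda>y. \<Sum>b\<in>Basis. (d\<sigma> y w \<bullet> b) *\<^sub>R dF (\<sigma> y) b) has_derivative
      (\<lambda>v. \<Sum>b\<in>Basis. (d\<sigma> q w \<bullet> b) *\<^sub>R ddF b (d\<sigma> q v) + (dd\<sigma> v \<bullet> b) *\<^sub>R dF (\<sigma> q) b)) (at q)"
    by (intro has_derivative_sum has_derivative_scaleR has_derivative_inner_left dd\<sigma>
        has_derivative_compose[OF d\<sigma>[OF U(2)] ddF])
  note D = frechet_derivative_at[OF this]
  have "frechet_derivative (\<lambda>y. frechet_derivative G (at y) w) (at q) =
      (\<lambda>v. \<Sum>b\<in>Basis. (d\<sigma> q w \<bullet> b) *\<^sub>R ddF b (d\<sigma> q v) + (dd\<sigma> v \<bullet> b) *\<^sub>R dF (\<sigma> q) b)"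
    unfolding D by (rule frechet_derivative_cong_open[OF U dGw])
  then have ddG: "frechet_derivative (\<lambda>y. frechet_derivative G (at y) w) (at q) v =
      (\<Sum>b\<in>Basis. (d\<sigma> q w \<bullet> b) *\<^sub>R ddF b (d\<sigma> q v)) + dF (\<sigma> q) (dd\<sigma> v)"
    by (simp only: expand[of "\<sigma> q" "dd\<sigma> v"] sum.distrib)
  have "((\<lambda>x. \<Sum>b\<in>Basis. (d\<sigma> q w \<bullet> b) *\<^sub>R dF x b) has_derivative
      (\<lambda>\<zeta>. \<Sum>b\<in>Basis. (d\<sigma> q w \<bullet> b) *\<^sub>R ddF b \<zeta>)) (at (\<sigma> q))"
    by (intro has_derivative_sum has_derivative_scaleR_right ddF)
  then have ddF_eq: "ddF (d\<sigma> q w) = (\<lambda>\<zeta>. \<Sum>b\<in>Basis. (d\<sigma> q w \<bullet> b) *\<^sub>R ddF b \<zeta>)"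
    unfolding ddF_def expand[of _ "d\<sigma> q w", symmetric] by (rule frechet_derivative_at[symmetric])
  have "range (\<lambda>v. dF (\<sigma> q) (d\<sigma> q v)) = dF (\<sigma> q) ` range (d\<sigma> q)"
    by (rule image_image[symmetric])
  then have ran: "range (\<lambda>v. dF (\<sigma> q) (d\<sigma> q v)) = range (dF (\<sigma> q))"
    using surj by (simp only: d\<sigma>_def)
  have "second_fundamental_form G q v w =
      normal_part (range (dF (\<sigma> q))) (ddF (d\<sigma> q w) (d\<sigma> q v) + dF (\<sigma> q) (dd\<sigma> v))"
    unfolding second_fundamental_form_def ddG dG[OF U(2)] ran ddF_eq ..
  also have "\<dots> = normal_part (range (dF (\<sigma> q))) (ddF (d\<sigma> q w) (d\<sigma> q v))"
    by (rule normal_part_cong[OF subspace_range_derivative[OF dF]]) simp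
  finally show ?thesis
    unfolding second_fundamental_form_def ddF_def dF_def d\<sigma>_def .
qed

text \<open>Gram-Schmidt in the tangent space, pulled back through the injective derivative.\<close>

lemma orthonormal_frame_exists:
  fixes F :: "'m::euclidean_space \<Rightarrow> 'b::euclidean_space"
  assumes dF: "(F has_derivative frechet_derivative F (at x)) (at x)"
    and inj: "inj (frechet_derivative F (at x))"
  shows "\<exists>e. orthonormal_frame F x e"
proof -
  define L where "L = frechet_derivative F (at x)"
  have lin: "linear L" and inj: "inj L"
    using dF inj has_derivative_linear unfolding L_def by auto
  obtain B where B: "B \<subseteq> range L" "pairwise orthogonal B" "\<And>x. x \<in> B \<Longrightarrow> norm x = 1"
      "independent B" "card B = dim (range L)"
    using orthonormal_basis_subspace[OF linear_subspace_image[OF lin subspace_UNIV]] by metis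
  have "card B = DIM('m)"
    using B(5) dim_image_eq[OF lin, of UNIV] inj by (simp add: inj_on_subset)
  then obtain \<beta> where \<beta>: "bij_betw \<beta> (Basis :: 'm set) B"
    using finite_same_card_bij[OF finite_Basis independent_imp_finite[OF B(4)]] by metis
  have mem: "\<beta> i \<in> B" if "i \<in> Basis" for i
    using bij_betwE[OF \<beta>] that by blast
  have "L (inv L (\<beta> i)) = \<beta> i" if "i \<in> Basis" for i
    using mem[OF that] B(1) by (intro f_inv_into_f) blast
  moreover have "\<beta> i \<bullet> \<beta> j = (if i = j then 1 else 0)" if "i \<in> Basis" "j \<in> Basis" for i j
  proof (cases "i = j")
    case True
    then show ?thesis using B(3)[OF mem[OF that(1)]] by (simp add: dot_square_norm)
  next
    case False
    then have "\<beta> i \<noteq> \<beta> j"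
      using \<beta> that unfolding bij_betw_def inj_on_def by blast
    then show ?thesis
      using B(2) mem that False unfolding pairwise_def orthogonal_def by simp
  qed
  ultimately show ?thesis
    unfolding orthonormal_frame_def L_def[symmetric] by (intro exI[of _ "\<lambda>i. inv L (\<beta> i)"]) simp
qed

text \<open>Traces over a frame reduce to sums \<open>\<Sum>\<^sub>i \<alpha>(E\<^sub>i) \<beta>(E\<^sub>i)\<close> with linear functionals \<open>\<alpha>, \<beta>\<close>. If \<open>\<xi>\<close>
  is the vector dual to \<open>\<alpha>\<close> for the induced metric, then \<open>\<xi> = \<Sum>\<^sub>i \<alpha>(E\<^sub>i) E\<^sub>i\<close> is the expansion of
  \<open>\<xi>\<close> in the frame, and such a sum equals \<open>\<beta>(\<xi>)\<close> for every frame. The frame is chosen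
  arbitrarily, but the dual vectors can be found by solving linear equations.\<close>

lemma orthonormal_frame_dual_sum:
  fixes F :: "'m::euclidean_space \<Rightarrow> 'b::euclidean_space"
  assumes dF: "(F has_derivative frechet_derivative F (at x)) (at x)"
    and E: "orthonormal_frame F x E"
    and \<alpha>: "\<And>v. frechet_derivative F (at x) \<xi> \<bullet> frechet_derivative F (at x) v = \<alpha> v"
  shows "(\<Sum>i\<in>Basis. \<alpha> (E i) *\<^sub>R E i) = \<xi>"
proof -
  define L where "L = frechet_derivative F (at x)"
  have lin: "linear L"
    using has_derivative_linear[OF dF] by (simp add: L_def)
  have on: "L (E i) \<bullet> L (E j) = (if i = j then 1 else 0)" if "i \<in> Basis" "j \<in> Basis" for i j
    using E that unfolding orthonormal_frame_def L_def by blast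
  have injE: "inj_on E Basis"
  proof (rule inj_onI)
    fix i j :: 'm assume "i \<in> Basis" "j \<in> Basis" "E i = E j"
    then show "i = j" using on[of i j] on[of i i] by (auto split: if_splits)
  qed
  have coeff: "(\<Sum>i\<in>Basis. c i *\<^sub>R L (E i)) \<bullet> L (E j) = c j" if "j \<in> Basis" for c j
    using that by (simp add: inner_sum_left on if_distrib sum.delta cong: if_cong)
  have "independent (E ` Basis)"
    unfolding independent_explicit_finite_subsets
  proof safe
    fix A u v assume A: "A \<subseteq> E ` Basis" "finite A" "(\<Sum>v\<in>A. u v *\<^sub>R v) = 0" "v \<in> A"
    then obtain j where j: "v = E j" "j \<in> Basis" by blast
    have "0 = L (\<Sum>v\<in>A. u v *\<^sub>R v) \<bullet> L v"
      using A(3) linear_0[OF lin] by simp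
    also have "\<dots> = (\<Sum>w\<in>A. u w * (L w \<bullet> L v))"
      by (simp add: linear_sum[OF lin] linear_scale[OF lin] inner_sum_left)
    also have "\<dots> = (\<Sum>w\<in>A. if w = v then u w else 0)"
    proof (rule sum.cong)
      fix w assume "w \<in> A"
      then obtain i where i: "w = E i" "i \<in> Basis" using A(1) by blast
      show "u w * (L w \<bullet> L v) = (if w = v then u w else 0)"
        using on[OF i(2) j(2)] i j inj_onD[OF injE] by auto
    qed simp
    also have "\<dots> = u v" using A by simp
    finally show "u v = 0" ..
  qed
  moreover have "card (E ` Basis) = DIM('m)"
    by (rule card_image[OF injE])
  ultimately have "span (E ` Basis) = UNIV"
    using card_ge_dim_independent[of "E ` Basis" UNIV] by auto
  then have "\<xi> \<in> span (E ` Basis)" by simp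
  then obtain c where c: "\<xi> = (\<Sum>w\<in>E ` Basis. c w *\<^sub>R w)"
    by (auto simp: span_finite)
  then have \<xi>: "\<xi> = (\<Sum>i\<in>Basis. c (E i) *\<^sub>R E i)"
    by (simp add: sum.reindex[OF injE])
  have "\<alpha> (E j) = c (E j)" if "j \<in> Basis" for j
  proof -
    have "\<alpha> (E j) = L \<xi> \<bullet> L (E j)"
      using \<alpha> by (simp add: L_def)
    also have "L \<xi> = (\<Sum>i\<in>Basis. c (E i) *\<^sub>R L (E i))"
      by (subst \<xi>) (simp add: linear_sum[OF lin] linear_scale[OF lin])
    finally show ?thesis using coeff[OF that] by simp
  qed
  then show ?thesis using \<xi> by simp
qed

section \<open>Submanifolds with a linear chart\<close>

text \<open>The prime example is a graph, where \<open>\<pi>\<close> forgets the dependent coordinates. The inverse of the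
  parametrization is required to extend linearly to the ambient space, so that composition with it
  preserves smoothness.\<close>

locale linear_chart =
  fixes \<Psi> :: "'m::euclidean_space \<Rightarrow> 'a::euclidean_space" and \<pi> :: "'a \<Rightarrow> 'm" and N :: "'a set"
  assumes smooth: "smooth_on UNIV \<Psi>"
    and bounded_linear_proj: "bounded_linear \<pi>"
    and proj_param: "\<pi> (\<Psi> x) = x"
    and range_param: "range \<Psi> = N"
begin

lemma local_parametrization_param: "local_parametrization N UNIV \<Psi>"
  unfolding local_parametrization_def
proof (intro conjI ballI)
  show "inj (frechet_derivative \<Psi> (at q))" for q
  proof -
    have "((\<lambda>x. \<pi> (\<Psi> x)) has_derivative (\<lambda>v. \<pi> (frechet_derivative \<Psi> (at q) v))) (at q)"
      by (rule bounded_linear.has_derivative[OF bounded_linear_proj smooth_onD_derivative[OF smooth]]) simp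
    then have "((\<lambda>x. x) has_derivative (\<lambda>v. \<pi> (frechet_derivative \<Psi> (at q) v))) (at q)"
      by (simp add: proj_param)
    then have "(\<lambda>v. \<pi> (frechet_derivative \<Psi> (at q) v)) = (\<lambda>v. v)"
      by (rule has_derivative_unique) simp
    then show ?thesis
      by (metis injI)
  qed
  have "continuous_on UNIV \<Psi>"
    using smooth unfolding smooth_on_def by (metis Ck_on.simps(1))
  then have "homeomorphism UNIV (range \<Psi>) \<Psi> \<pi>"
    using linear_continuous_on[OF bounded_linear_proj]
    by (auto simp: homeomorphism_def proj_param image_image)
  then show "\<exists>g. homeomorphism UNIV (range \<Psi>) \<Psi> g" by blast
  show "openin (top_of_set N) (range \<Psi>)"
    by (simp add: range_param)
qed (use smooth in auto)

lemma submanifold_range: "submanifold TYPE('m) N"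
  unfolding submanifold_def using local_parametrization_param range_param by blast

text \<open>Since \<open>\<pi>\<close> is linear on the ambient space, the change of parameters \<open>\<pi> \<circ> \<psi>\<close> from an arbitrary
  local parametrization to the global one inherits smoothness from \<open>\<psi>\<close>. Its derivative is
  injective because it is applied first in the injective derivative of \<open>\<psi> = \<Psi> \<circ> (\<pi> \<circ> \<psi>)\<close>,
  and then bijective because both parameter domains have the same dimension.\<close>

lemma transition_map:
  fixes \<psi> :: "'m \<Rightarrow> 'a"
  assumes "local_parametrization N U \<psi>"
  shows "\<And>y. y \<in> U \<Longrightarrow> \<psi> y = \<Psi> (\<pi> (\<psi> y))"
    and "smooth_on U (\<lambda>y. \<pi> (\<psi> y))"
    and "\<And>q. q \<in> U \<Longrightarrow> bij (frechet_derivative (\<lambda>y. \<pi> (\<psi> y)) (at q))"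
proof -
  have inj: "inj (frechet_derivative \<psi> (at q))" if "q \<in> U" for q
    using assms that unfolding local_parametrization_def by auto
  have "openin (top_of_set N) (\<psi> ` U)"
    using assms by (simp add: local_parametrization_def)
  then have sub: "\<psi> ` U \<subseteq> N"
    by (rule openin_imp_subset)
  show eq: "\<psi> y = \<Psi> (\<pi> (\<psi> y))" if "y \<in> U" for y
  proof -
    have "\<psi> y \<in> range \<Psi>"
      using sub that by (auto simp: range_param)
    then obtain x where "\<psi> y = \<Psi> x" ..
    then show ?thesis by (simp add: proj_param)
  qed
  have U: "open U" and \<psi>: "smooth_on U \<psi>"
    using assms unfolding local_parametrization_def by auto
  show \<sigma>: "smooth_on U (\<lambda>y. \<pi> (\<psi> y))"
    by (rule smooth_on_linear[OF U bounded_linear_proj \<psi>])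
  show "bij (frechet_derivative (\<lambda>y. \<pi> (\<psi> y)) (at q))" if "q \<in> U" for q
  proof -
    have "frechet_derivative \<psi> (at q) =
        (\<lambda>v. frechet_derivative \<Psi> (at (\<pi> (\<psi> q))) (frechet_derivative (\<lambda>y. \<pi> (\<psi> y)) (at q) v))"
      by (rule frechet_derivative_comp_open[OF U that eq \<sigma> smooth])
    then have "inj (frechet_derivative (\<lambda>y. \<pi> (\<psi> y)) (at q))"
      using inj[OF that] by (metis (mono_tags, lifting) inj_def)
    moreover have "linear (frechet_derivative (\<lambda>y. \<pi> (\<psi> y)) (at q))"
      by (rule has_derivative_linear[OF smooth_onD_derivative[OF \<sigma> that]])
    ultimately show ?thesis
      by (simp add: bij_def linear_inj_imp_surj)
  qed
qed

text \<open>An immersion \<open>f\<close> of \<open>N\<close> can now be studied through the single map \<open>F = f \<circ> \<Psi>\<close>: every other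
  parametrization produces \<open>F\<close> composed with a local diffeomorphism.\<close>

context
  fixes f :: "'a \<Rightarrow> 'b::euclidean_space" and F :: "'m \<Rightarrow> 'b"
  assumes f_param: "\<And>x. f (\<Psi> x) = F x"
    and smooth_F: "smooth_on UNIV F"
    and inj_F: "\<And>x. inj (frechet_derivative F (at x))"
begin

lemma comp_local_parametrization:
  fixes \<psi> :: "'m \<Rightarrow> 'a"
  assumes "local_parametrization N U \<psi>" "y \<in> U"
  shows "(f \<circ> \<psi>) y = F (\<pi> (\<psi> y))"
proof -
  have "f (\<psi> y) = f (\<Psi> (\<pi> (\<psi> y)))"
    by (rule arg_cong[OF transition_map(1)[OF assms]])
  then show ?thesis by (simp add: f_param)
qed

lemma derivative_local_parametrization:
  fixes \<psi> :: "'m \<Rightarrow> 'a"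
  assumes "local_parametrization N U \<psi>" "q \<in> U"
  shows "frechet_derivative (f \<circ> \<psi>) (at q) =
    (\<lambda>v. frechet_derivative F (at (\<pi> (\<psi> q))) (frechet_derivative (\<lambda>y. \<pi> (\<psi> y)) (at q) v))"
  using assms
  by (intro frechet_derivative_comp_open[OF _ _ comp_local_parametrization[OF assms(1)]
        transition_map(2)[OF assms(1)] smooth_F])
    (auto simp: local_parametrization_def)

lemma immersionI: "immersion TYPE('m) N f"
  unfolding immersion_def
proof (intro conjI allI impI ballI)
  show "submanifold TYPE('m) N" by (rule submanifold_range)
next
  fix U and \<psi> :: "'m \<Rightarrow> 'a" assume \<psi>: "local_parametrization N U \<psi>"
  then have U: "open U" unfolding local_parametrization_def by blast
  show "smooth_on U (f \<circ> \<psi>)"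
  proof (rule smooth_on_cong[OF U])
    show "smooth_on U (\<lambda>y. F (\<pi> (\<psi> y)))"
      using smooth_on_compose[OF U _ transition_map(2)[OF \<psi>] smooth_F] by simp
    show "F (\<pi> (\<psi> y)) = (f \<circ> \<psi>) y" if "y \<in> U" for y
      by (rule comp_local_parametrization[OF \<psi> that, symmetric])
  qed
  fix q assume q: "q \<in> U"
  show "inj (frechet_derivative (f \<circ> \<psi>) (at q))"
    unfolding derivative_local_parametrization[OF \<psi> q]
    using inj_F transition_map(3)[OF \<psi> q] by (simp add: inj_def bij_def)
qed

lemma tangent_space_eq: "tangent_space TYPE('m) N f (\<Psi> x) = range (frechet_derivative F (at x))"
proof (intro set_eqI iffI)
  fix w assume "w \<in> tangent_space TYPE('m) N f (\<Psi> x)"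
  then obtain U and \<psi> :: "'m \<Rightarrow> 'a" and q v where *: "local_parametrization N U \<psi>" "q \<in> U" "\<psi> q = \<Psi> x"
      "w = frechet_derivative (f \<circ> \<psi>) (at q) v"
    unfolding tangent_space_def by blast
  then show "w \<in> range (frechet_derivative F (at x))"
    by (simp add: derivative_local_parametrization[OF *(1,2)] proj_param)
next
  fix w assume "w \<in> range (frechet_derivative F (at x))"
  moreover have "f \<circ> \<Psi> = F" using f_param by auto
  ultimately show "w \<in> tangent_space TYPE('m) N f (\<Psi> x)"
    unfolding tangent_space_def using local_parametrization_param by fastforce
qed

text \<open>The frames of \<open>f \<circ> \<psi>\<close> correspond to frames of \<open>F\<close> under the derivative of the change of
  parameters, with equal second fundamental forms. Asking for the same trace \<open>\<eta>\<close> over every frame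
  of \<open>F\<close> therefore settles both uniqueness of the value and, with one frame, its existence.\<close>

lemma mean_curvature_eqI:
  assumes \<eta>: "\<And>E. orthonormal_frame F x E \<Longrightarrow>
    (\<Sum>i\<in>Basis. second_fundamental_form F x (E i) (E i)) = \<eta>"
  shows "mean_curvature TYPE('m) N f (\<Psi> x) = \<eta>"
  unfolding mean_curvature_def
proof (rule the_equality)
  obtain E where "orthonormal_frame F x E"
    using orthonormal_frame_exists[OF smooth_onD_derivative[OF smooth_F] inj_F] by blast
  moreover have "f \<circ> \<Psi> = F" using f_param by auto
  ultimately show "\<exists>U (\<psi> :: 'm \<Rightarrow> 'a) q e. local_parametrization N U \<psi> \<and> q \<in> U \<and> \<psi> q = \<Psi> x \<and>
      orthonormal_frame (f \<circ> \<psi>) q e \<and>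
      \<eta> = (\<Sum>i\<in>Basis. second_fundamental_form (f \<circ> \<psi>) q (e i) (e i))"
    using local_parametrization_param \<eta> by (metis UNIV_I)
next
  fix \<theta> assume "\<exists>U (\<psi> :: 'm \<Rightarrow> 'a) q e. local_parametrization N U \<psi> \<and> q \<in> U \<and> \<psi> q = \<Psi> x \<and>
      orthonormal_frame (f \<circ> \<psi>) q e \<and>
      \<theta> = (\<Sum>i\<in>Basis. second_fundamental_form (f \<circ> \<psi>) q (e i) (e i))"
  then obtain U and \<psi> :: "'m \<Rightarrow> 'a" and q e where \<psi>: "local_parametrization N U \<psi>" and q: "q \<in> U" "\<psi> q = \<Psi> x"
    and e: "orthonormal_frame (f \<circ> \<psi>) q e"
    and \<theta>: "\<theta> = (\<Sum>i\<in>Basis. second_fundamental_form (f \<circ> \<psi>) q (e i) (e i))"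
    by blast
  define d\<sigma> where "d\<sigma> = frechet_derivative (\<lambda>y. \<pi> (\<psi> y)) (at q)"
  have U: "open U" using \<psi> unfolding local_parametrization_def by blast
  have \<sigma>q: "\<pi> (\<psi> q) = x" by (simp add: q proj_param)
  have "orthonormal_frame F x (\<lambda>i. d\<sigma> (e i))"
    using e unfolding orthonormal_frame_def derivative_local_parametrization[OF \<psi> q(1)] \<sigma>q d\<sigma>_def .
  then have "(\<Sum>i\<in>Basis. second_fundamental_form F x (d\<sigma> (e i)) (d\<sigma> (e i))) = \<eta>"
    by (rule \<eta>)
  moreover have "second_fundamental_form (f \<circ> \<psi>) q v w = second_fundamental_form F x (d\<sigma> v) (d\<sigma> w)" for v w
    using second_fundamental_form_reparametrize[OF U q(1) comp_local_parametrization[OF \<psi>]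
        transition_map(2)[OF \<psi>] smooth_F] transition_map(3)[OF \<psi> q(1)]
    unfolding \<sigma>q d\<sigma>_def bij_def by blast
  ultimately show "\<theta> = \<eta>" using \<theta> by simp
qed

end

end

section \<open>The orbit immersion in coordinates\<close>

text \<open>Real points with moment \<open>r\<close> form the graph of a quadratic function over \<open>\<real>\<^sup>d\<close>, which
  parametrizes the domain of the immersion by \<open>(x, t)\<close> with \<open>x \<in> \<real>\<^sup>d\<close> and \<open>t \<in> H\<close>.\<close>

definition slice_point :: "real ^ 'd::finite \<Rightarrow> real \<Rightarrow> (real ^ 'd) \<times> H \<Rightarrow> 'd cspace \<times> H" where
  "slice_point lam r p =
     (((\<chi> i. of_real (fst p $ i)), of_real (r - 1/2 * (\<Sum>i\<in>UNIV. lam $ i * (fst p $ i)\<^sup>2))), snd p)"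

definition base_coordinates :: "'d::finite cspace \<times> H \<Rightarrow> (real ^ 'd) \<times> H" where
  "base_coordinates q = ((\<chi> i. Re (fst (fst q) $ i)), snd q)"

definition orbit_point :: "real ^ 'd::finite \<Rightarrow> real \<Rightarrow> (real ^ 'd) \<times> H \<Rightarrow> 'd cspace" where
  "orbit_point lam r p =
     ((\<chi> i. of_real (fst p $ i) * cis (lam $ i * snd p)),
      of_real (r - 1/2 * (\<Sum>i\<in>UNIV. lam $ i * (fst p $ i)\<^sup>2)) + \<i> * of_real (snd p))"

text \<open>The gradient of \<open>\<Sum>\<^sub>i \<lambda>\<^sub>i x\<^sub>i\<^sup>2 / 2\<close>, and at the same time the vector of signed speeds at which
  the action rotates the first \<open>d\<close> coordinates. This coincidence makes the two corrections to the
  trace fit together.\<close>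

definition slope :: "real ^ 'd::finite \<Rightarrow> (real ^ 'd) \<times> H \<Rightarrow> real ^ 'd" where
  "slope lam p = (\<chi> i. lam $ i * fst p $ i)"

definition d_orbit :: "real ^ 'd::finite \<Rightarrow> (real ^ 'd) \<times> H \<Rightarrow> (real ^ 'd) \<times> H \<Rightarrow> 'd cspace" where
  "d_orbit lam p v =
     ((\<chi> i. (of_real (fst v $ i) + \<i> * of_real (slope lam p $ i * snd v)) * cis (lam $ i * snd p)),
      of_real (- (slope lam p \<bullet> fst v)) + \<i> * of_real (snd v))"

text \<open>The argument order is that of \<open>has_derivative_d_orbit\<close> below: \<open>w\<close> is the direction of the first
  derivative, \<open>v\<close> that of the second.\<close>

definition dd_orbit ::
    "real ^ 'd::finite \<Rightarrow> (real ^ 'd) \<times> H \<Rightarrow> (real ^ 'd) \<times> H \<Rightarrow> (real ^ 'd) \<times> H \<Rightarrow> 'd cspace" where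
  "dd_orbit lam p w v =
     ((\<chi> i. (\<i> * of_real (lam $ i * (fst v $ i * snd w + fst w $ i * snd v))
              - of_real (lam $ i * slope lam p $ i * (snd v * snd w))) * cis (lam $ i * snd p)),
      of_real (- (\<Sum>i\<in>UNIV. lam $ i * (fst v $ i * fst w $ i))))"

lemma has_derivative_orbit_point: "(orbit_point lam r has_derivative d_orbit lam p) (at p)"
  unfolding orbit_point_def[abs_def] d_orbit_def[abs_def]
proof (rule has_derivative_Pair[OF has_derivative_vec_lambda])
  show "((\<lambda>p. of_real (fst p $ i) * cis (lam $ i * snd p)) has_derivative
      (\<lambda>v. (of_real (fst v $ i) + \<i> * of_real (slope lam p $ i * snd v)) * cis (lam $ i * snd p))) (at p)" for i
    by (auto intro!: derivative_eq_intros bounded_linear.has_derivative[OF bounded_linear_vec_nth]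
        simp: slope_def scaleR_conv_of_real algebra_simps)
  show "((\<lambda>p. of_real (r - 1/2 * (\<Sum>i\<in>UNIV. lam $ i * (fst p $ i)\<^sup>2)) + \<i> * of_real (snd p) :: complex) has_derivative
      (\<lambda>v. of_real (- (slope lam p \<bullet> fst v)) + \<i> * of_real (snd v))) (at p)"
    by (auto intro!: derivative_eq_intros bounded_linear.has_derivative[OF bounded_linear_vec_nth]
        simp: slope_def inner_vec_def algebra_simps sum_distrib_left)
qed

lemma has_derivative_d_orbit: "((\<lambda>p. d_orbit lam p w) has_derivative dd_orbit lam p w) (at p)"
  unfolding d_orbit_def dd_orbit_def[abs_def]
proof (rule has_derivative_Pair[OF has_derivative_vec_lambda])
  show "((\<lambda>p. (of_real (fst w $ i) + \<i> * of_real (slope lam p $ i * snd w)) * cis (lam $ i * snd p)) has_derivative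
      (\<lambda>v. (\<i> * of_real (lam $ i * (fst v $ i * snd w + fst w $ i * snd v))
              - of_real (lam $ i * slope lam p $ i * (snd v * snd w))) * cis (lam $ i * snd p))) (at p)" for i
    unfolding slope_def vec_lambda_beta
    by (auto intro!: derivative_eq_intros bounded_linear.has_derivative[OF bounded_linear_vec_nth]
        simp: scaleR_conv_of_real algebra_simps)
  show "((\<lambda>p. of_real (- (slope lam p \<bullet> fst w)) + \<i> * of_real (snd w) :: complex) has_derivative
      (\<lambda>v. of_real (- (\<Sum>i\<in>UNIV. lam $ i * (fst v $ i * fst w $ i))))) (at p)"
    unfolding slope_def inner_vec_def vec_lambda_beta
    by (auto intro!: derivative_eq_intros bounded_linear.has_derivative[OF bounded_linear_vec_nth]
        simp: algebra_simps)
qed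

lemma frechet_derivative_orbit_point: "frechet_derivative (orbit_point lam r) (at p) = d_orbit lam p"
  by (rule frechet_derivative_at[OF has_derivative_orbit_point, symmetric])

lemma second_fundamental_form_orbit_point:
  "second_fundamental_form (orbit_point lam r) p v w = normal_part (range (d_orbit lam p)) (dd_orbit lam p w v)"
  unfolding second_fundamental_form_def frechet_derivative_orbit_point
  by (simp add: frechet_derivative_at[OF has_derivative_d_orbit, symmetric])

text \<open>The terms mixing slice and orbit directions cancel because rotations move a real point in
  imaginary directions: this is the Lagrangian character of the real slice. What remains is a rank
  one perturbation of the Euclidean metric on the slice and a scalar on the orbit, both of which can
  be inverted by hand.\<close>

lemma inner_d_orbit:
  "d_orbit lam p v \<bullet> d_orbit lam p w =
     fst v \<bullet> fst w + (slope lam p \<bullet> fst v) * (slope lam p \<bullet> fst w)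
     + (1 + slope lam p \<bullet> slope lam p) * (snd v * snd w)"
proof -
  \<comment> \<open>The factors \<open>cis (\<lambda>\<^sub>i t)\<close> are isometries, so that the metric is the same along each orbit.\<close>
  have rot: "(a * cis t) \<bullet> (b * cis t) = a \<bullet> b" for a b t
  proof -
    have "(cos t)\<^sup>2 + (sin t)\<^sup>2 = 1" by simp
    then have "(Re a * cos t - Im a * sin t) * (Re b * cos t - Im b * sin t) +
        (Re a * sin t + Im a * cos t) * (Re b * sin t + Im b * cos t) = Re a * Re b + Im a * Im b"
      by algebra
    then show ?thesis by (simp add: inner_complex_def)
  qed
  have "(\<Sum>i\<in>UNIV. (of_real (fst v $ i) + \<i> * of_real (slope lam p $ i * snd v))
        \<bullet> (of_real (fst w $ i) + \<i> * of_real (slope lam p $ i * snd w)))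
      = fst v \<bullet> fst w + (slope lam p \<bullet> slope lam p) * (snd v * snd w)"
    by (simp add: inner_complex_def inner_vec_def sum.distrib sum_distrib_left mult_ac)
  then show ?thesis
    unfolding d_orbit_def by (simp add: inner_vec_def[of "vec_lambda _"] rot) (simp add: inner_complex_def algebra_simps)
qed

lemma inj_d_orbit: "inj (d_orbit lam p)"
proof (rule injI)
  fix v w assume eq: "d_orbit lam p v = d_orbit lam p w"
  have s: "snd v = snd w"
    using arg_cong[OF eq, of "\<lambda>z. Im (snd z)"] by (simp add: d_orbit_def)
  have "fst v $ i = fst w $ i" for i
    using arg_cong[OF eq, of "\<lambda>z. fst z $ i"] s by (simp add: d_orbit_def)
  then show "v = w" using s by (simp add: prod_eq_iff vec_eq_iff)
qed

text \<open>The heart of the matter. With \<open>a\<close> the slope and \<open>s = 1 + |a|\<^sup>2\<close>, the inverse metric is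
  \<open>I - a a\<^sup>T / s\<close> on the slice and \<open>1 / s\<close> on the orbit. The trace with the flat inverse metric \<open>I\<close>
  is exactly the translation vector. The correction \<open>- a a\<^sup>T / s\<close> and the orbit contribution add up
  to a vector tangent to the slice, with parameter direction \<open>- \<lambda>\<^sub>i a\<^sub>i / s\<close>.\<close>

lemma trace_dd_orbit:
  assumes E: "orthonormal_frame (orbit_point lam r) p E"
  shows "(\<Sum>b\<in>Basis. dd_orbit lam p (E b) (E b)) - translation_vector lam =
    d_orbit lam p ((\<chi> i. - (lam $ i * slope lam p $ i) / (1 + slope lam p \<bullet> slope lam p)), 0)"
proof -
  define a where "a = slope lam p"
  define s where "s = 1 + a \<bullet> a"
  have s: "s > 0" unfolding s_def by (simp add: add_pos_nonneg)
  \<comment> \<open>The vectors dual to the coordinate functionals \<open>t\<close> and \<open>x\<^sub>i\<close>, i.e. the rows of the inverse metric,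
    give all second moments of the frame that the trace involves.\<close>
  note dual = orthonormal_frame_dual_sum[OF _ E, unfolded frechet_derivative_orbit_point inner_d_orbit,
      OF has_derivative_orbit_point, folded a_def, folded s_def]
  have "(\<Sum>b\<in>Basis. snd (E b) *\<^sub>R E b) = (0, 1 / s)"
    by (rule dual) (use s in simp)
  from arg_cong[OF this, of fst] arg_cong[OF this, of snd]
  have t: "(\<Sum>b\<in>Basis. snd (E b) *\<^sub>R fst (E b)) = 0" "(\<Sum>b\<in>Basis. snd (E b) * snd (E b)) = 1 / s"
    by (simp_all add: fst_sum snd_sum)
  from arg_cong[OF t(1), of "\<lambda>x. x $ i" for i]
  have tx: "(\<Sum>b\<in>Basis. snd (E b) * fst (E b) $ i) = 0" for i
    by simp
  have xx: "(\<Sum>b\<in>Basis. fst (E b) $ i * fst (E b) $ i) = 1 - a $ i * a $ i / s" for i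
  proof -
    have "(\<Sum>b\<in>Basis. fst (E b) $ i *\<^sub>R E b) = (axis i 1 - (a $ i / s) *\<^sub>R a, 0)"
    proof (rule dual)
      fix v
      have aa: "a \<bullet> a = s - 1" by (simp add: s_def)
      show "fst (axis i 1 - (a $ i / s) *\<^sub>R a, 0) \<bullet> fst v
          + (a \<bullet> fst (axis i 1 - (a $ i / s) *\<^sub>R a, 0)) * (a \<bullet> fst v)
          + s * (snd (axis i 1 - (a $ i / s) *\<^sub>R a, 0) * snd v) = fst v $ i"
        using s by (simp add: aa inner_diff_left inner_diff_right inner_axis inner_axis' field_simps)
    qed
    from arg_cong[OF this, of "\<lambda>v. fst v $ i"] show ?thesis
      by (simp add: fst_sum axis_def)
  qed
  show ?thesis
    unfolding a_def[symmetric] s_def[symmetric]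
  proof (rule prod_eqI)
    have "(\<Sum>b\<in>Basis. fst (dd_orbit lam p (E b) (E b)) $ i)
        = of_real (- (lam $ i * a $ i) / s) * cis (lam $ i * snd p)" for i
    proof -
      have "(\<Sum>b\<in>Basis. fst (dd_orbit lam p (E b) (E b)) $ i) =
          (\<i> * of_real (2 * lam $ i * (\<Sum>b\<in>Basis. snd (E b) * fst (E b) $ i))
           - of_real (lam $ i * a $ i * (\<Sum>b\<in>Basis. snd (E b) * snd (E b)))) * cis (lam $ i * snd p)"
        by (simp add: dd_orbit_def a_def sum_distrib_left sum_distrib_right sum_subtractf algebra_simps)
      then show ?thesis by (simp add: tx t)
    qed
    then show "fst ((\<Sum>b\<in>Basis. dd_orbit lam p (E b) (E b)) - translation_vector lam) =
        fst (d_orbit lam p ((\<chi> i. - (lam $ i * a $ i) / s), 0))"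
      by (simp add: d_orbit_def translation_vector_def vec_eq_iff fst_sum)
    have "(\<Sum>b\<in>Basis. snd (dd_orbit lam p (E b) (E b)))
        = of_real (- (\<Sum>b\<in>Basis. \<Sum>i\<in>UNIV. lam $ i * (fst (E b) $ i * fst (E b) $ i)))"
      by (simp add: dd_orbit_def sum_negf)
    also have "(\<Sum>b\<in>Basis. \<Sum>i\<in>UNIV. lam $ i * (fst (E b) $ i * fst (E b) $ i)) =
        (\<Sum>i\<in>UNIV. lam $ i * (1 - a $ i * a $ i / s))"
      by (subst sum.swap) (simp add: sum_distrib_left[symmetric] xx)
    also have "\<dots> = (\<Sum>i\<in>UNIV. lam $ i) + (a \<bullet> (\<chi> i. - (lam $ i * a $ i) / s))"
      by (simp add: inner_vec_def algebra_simps sum_subtractf sum_negf)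
    finally show "snd ((\<Sum>b\<in>Basis. dd_orbit lam p (E b) (E b)) - translation_vector lam) =
        snd (d_orbit lam p ((\<chi> i. - (lam $ i * a $ i) / s), 0))"
      by (simp add: d_orbit_def translation_vector_def snd_sum a_def)
  qed
qed

lemma smooth_height:
  "smooth_on UNIV (\<lambda>p :: (real ^ 'd::finite) \<times> H. r - 1/2 * (\<Sum>i\<in>UNIV. lam $ i * (fst p $ i)\<^sup>2))"
proof -
  have coord: "smooth_on UNIV (\<lambda>p :: (real ^ 'd) \<times> H. fst p $ i)" for i
    by (intro smooth_on_linear[OF open_UNIV bounded_linear_vec_nth]
        smooth_on_linear[OF open_UNIV bounded_linear_fst] smooth_on_ident open_UNIV)
  have "smooth_on UNIV (\<lambda>p :: (real ^ 'd) \<times> H. r + (\<Sum>i\<in>UNIV. (- 1/2 * lam $ i) * (fst p $ i * fst p $ i)))"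
    by (intro smooth_on_add smooth_on_sum smooth_on_const open_UNIV finite
        smooth_on_linear[OF open_UNIV bounded_linear_mult_right]
        smooth_on_bilinear[OF open_UNIV bounded_bilinear_mult] coord)
  then show ?thesis
    by (simp add: power2_eq_square sum_distrib_left sum_negf mult.assoc)
qed

lemma smooth_slice_point: "smooth_on UNIV (slice_point lam r)"
  unfolding slice_point_def[abs_def]
  by (intro smooth_on_Pair smooth_on_vec_lambda open_UNIV smooth_on_linear[OF open_UNIV bounded_linear_of_real]
      smooth_height smooth_on_linear[OF open_UNIV bounded_linear_vec_nth]
      smooth_on_linear[OF open_UNIV bounded_linear_fst] smooth_on_linear[OF open_UNIV bounded_linear_snd]
      smooth_on_ident)

lemma smooth_orbit_point: "smooth_on UNIV (orbit_point lam r)"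
  unfolding orbit_point_def[abs_def]
  by (intro smooth_on_Pair smooth_on_vec_lambda smooth_on_add open_UNIV
      smooth_on_bilinear[OF open_UNIV bounded_bilinear_mult] smooth_on_cis smooth_on_const
      smooth_on_linear[OF open_UNIV bounded_linear_of_real]
      smooth_height smooth_on_linear[OF open_UNIV bounded_linear_vec_nth]
      smooth_on_linear[OF open_UNIV bounded_linear_fst] smooth_on_linear[OF open_UNIV bounded_linear_snd]
      smooth_on_ident)

lemma bounded_linear_base_coordinates: "bounded_linear base_coordinates"
  by (rule linear_conv_bounded_linear[THEN iffD1], rule linearI)
    (auto simp: base_coordinates_def vec_eq_iff)

text \<open>An element of the dual of \<open>\<real>\<close> is determined by its value at \<open>\<xi>\<^sub>0 = 1\<close>, so the equation
  \<open>\<mu>\<^sub>H(z) = c\<close> is the scalar equation with right-hand side \<open>c 1\<close>.\<close>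

lemma range_slice_point: "range (slice_point lam (blinfun_apply c 1)) = phi_domain lam c"
proof (intro set_eqI iffI)
  fix q assume "q \<in> range (slice_point lam (blinfun_apply c 1))"
  then obtain p where q: "q = slice_point lam (blinfun_apply c 1) p" by blast
  have "moment_map lam (fst q) = blinfun_apply c 1 *\<^sub>R xi_dual"
    by (simp add: moment_map_def q slice_point_def)
  also have "\<dots> = c"
  proof (rule blinfun_eqI)
    show "blinfun_apply (blinfun_apply c 1 *\<^sub>R xi_dual) y = blinfun_apply c y" for y
      using blinfun.scaleR_right[of c y 1] by (simp add: xi_dual_def scaleR_blinfun.rep_eq)
  qed
  finally show "q \<in> phi_domain lam c"
    by (auto simp: phi_domain_def real_points_def q slice_point_def mem_Times_iff)
next
  fix q assume q: "q \<in> phi_domain lam c"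
  have re: "of_real (Re (fst (fst q) $ i)) = fst (fst q) $ i" "of_real (Re (snd (fst q))) = snd (fst q)" for i
    using q by (auto simp: phi_domain_def real_points_def mem_Times_iff)
  have cm: "cmod (fst (fst q) $ i) = \<bar>Re (fst (fst q) $ i)\<bar>" for i
    using norm_of_real[of "Re (fst (fst q) $ i)", where 'a = complex] unfolding re .
  have "moment_map lam (fst q) = c"
    using q by (auto simp: phi_domain_def)
  then have "blinfun_apply (moment_map lam (fst q)) 1 = blinfun_apply c 1" by simp
  then have "Re (snd (fst q)) =
      blinfun_apply c 1 - 1/2 * (\<Sum>i\<in>UNIV. lam $ i * (Re (fst (fst q) $ i))\<^sup>2)"
    by (simp add: moment_map_def xi_dual_def scaleR_blinfun.rep_eq cm)
  then have "q = slice_point lam (blinfun_apply c 1) (base_coordinates q)"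
    using re(2) by (simp add: slice_point_def base_coordinates_def prod_eq_iff vec_eq_iff re(1))
  then show "q \<in> range (slice_point lam (blinfun_apply c 1))" by blast
qed

lemma linear_chart_slice_point:
  "linear_chart (slice_point lam (blinfun_apply c 1)) base_coordinates (phi_domain lam c)"
proof (rule linear_chart.intro)
  show "base_coordinates (slice_point lam (blinfun_apply c 1) x) = x" for x
    by (simp add: base_coordinates_def slice_point_def prod_eq_iff vec_eq_iff)
qed (rule smooth_slice_point bounded_linear_base_coordinates range_slice_point)+

lemma phi_slice_point: "phi lam (slice_point lam r p) = orbit_point lam r p"
  by (simp add: phi_def slice_point_def act_def orbit_point_def cis_conv_exp)

section \<open>The translating soliton\<close>

theorem proposition3p6:
  fixes lam :: "real ^ 'd::finite" and c :: dual_lie_H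
  shows "immersion TYPE((real ^ 'd) \<times> H) (phi_domain lam c) (phi lam) \<and>
    (\<forall>p\<in>phi_domain lam c.
       mean_curvature TYPE((real ^ 'd) \<times> H) (phi_domain lam c) (phi lam) p =
       normal_part (tangent_space TYPE((real ^ 'd) \<times> H) (phi_domain lam c) (phi lam) p)
         (translation_vector lam)) \<and>
    translating_soliton TYPE((real ^ 'd) \<times> H) (phi_domain lam c) (phi lam)"
proof -
  define r where "r = blinfun_apply c 1"
  interpret linear_chart "slice_point lam r" base_coordinates "phi_domain lam c"
    unfolding r_def by (rule linear_chart_slice_point)
  have inj: "inj (frechet_derivative (orbit_point lam r) (at x))" for x
    unfolding frechet_derivative_orbit_point by (rule inj_d_orbit)
  note facts = phi_slice_point[of lam r] smooth_orbit_point[of lam r] inj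
  have imm: "immersion TYPE((real ^ 'd) \<times> H) (phi_domain lam c) (phi lam)"
    by (rule immersionI[OF facts])
  have "mean_curvature TYPE((real ^ 'd) \<times> H) (phi_domain lam c) (phi lam) p =
      normal_part (tangent_space TYPE((real ^ 'd) \<times> H) (phi_domain lam c) (phi lam) p) (translation_vector lam)"
    if p: "p \<in> phi_domain lam c" for p
  proof -
    obtain x where x: "p = slice_point lam r x"
      using p range_param by blast
    define V where "V = range (d_orbit lam x)"
    have V: "subspace V"
      unfolding V_def by (rule subspace_range_derivative[OF has_derivative_orbit_point])
    have "mean_curvature TYPE((real ^ 'd) \<times> H) (phi_domain lam c) (phi lam) (slice_point lam r x) =
        normal_part V (translation_vector lam)"
    proof (rule mean_curvature_eqI[OF facts])
      fix E assume E: "orthonormal_frame (orbit_point lam r) x E"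
      have "(\<Sum>i\<in>Basis. second_fundamental_form (orbit_point lam r) x (E i) (E i)) =
          normal_part V (\<Sum>i\<in>Basis. dd_orbit lam x (E i) (E i))"
        unfolding second_fundamental_form_orbit_point V_def[symmetric] by (rule normal_part_sum[OF V])
      also have "\<dots> = normal_part V (translation_vector lam)"
        by (rule normal_part_cong[OF V]) (simp add: trace_dd_orbit[OF E] V_def)
      finally show "(\<Sum>i\<in>Basis. second_fundamental_form (orbit_point lam r) x (E i) (E i)) =
          normal_part V (translation_vector lam)" .
    qed
    then show ?thesis
      unfolding x tangent_space_eq[OF facts] frechet_derivative_orbit_point V_def .
  qed
  with imm show ?thesis
    unfolding translating_soliton_def by blast
qed

end
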